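(* Let $V$ be a $v$-dimensional vector space over $\mathrm{GF}(q)$, let $\{\mathbf 0\}=U_0<U_1<\dots<U_v=V$ be a maximal chain of subspaces of $V$, $k\in\{0,\dots,v\}$ and $s\in\{0,\dots,v-k-1\}$. Then the set of $k$-dimensional subspaces of $V$ is the disjoint union \[\genfrac{[}{]}{0pt}{}{V}{k}_q=\bigcup_{i=0}^k\genfrac{[}{]}{0pt}{}{U_{s+i}}{i}_q *_{\overline{U_{s+i+1}/U_{s+i}}}\genfrac{[}{]}{0pt}{}{V/U_{s+i+1}}{k-i}_q,\] and consequently \[\begin{bmatrix} v\\ k\end{bmatrix}_q=\sum_{i=0}^k q^{(s+1)(k-i)}\begin{bmatrix} s+i\\ i\end{bmatrix}_q\begin{bmatrix} v-s-i-1\\ k-i\end{bmatrix}_q.\]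
   Context: $\genfrac{[}{]}{0pt}{}{W}{j}_q$ denotes the set of $j$-dimensional subspaces of a $\mathrm{GF}(q)$-vector space $W$, and $\begin{bmatrix} a\\ b\end{bmatrix}_q$ its size (Gaussian binomial coefficient). For $U_1\le U_2\le V$, a subspace $K\le V$ avoids the factor $U_2/U_1$ if $U_1\cap K=U_2\cap K$. For $K_1\le U_1$ and $U_2\le K_2\le V$, the avoiding join is $K_1 *_{\overline{U_2/U_1}} K_2/U_2=\{K\le V: U_1\cap K=K_1,\ U_2+K=K_2,\ K\text{ avoids }U_2/U_1\}$. For a set $\mathcal{B}^{(1)}$ of subspaces of $U_1$ and a set $\mathcal{B}^{(2)}$ of subspaces of $V/U_2$, $\mathcal{B}^{(1)} *_{\overline{U_2/U_1}}\mathcal{B}^{(2)}$ is the union of $B^{(1)} *_{\overline{U_2/U_1}} K_2/U_2$ over all $B^{(1)}\in\mathcal{B}^{(1)}$ and all $K_2\ge U_2$ with $K_2/U_2\in\mathcal{B}^{(2)}$ (empty if either set is empty). *)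

theory Defs
  imports "Jordan_Normal_Form.Missing_VectorSpace" "HOL-Algebra.AbelCoset" "HOL-Library.Disjoint_Sets"
begin

(* The multiplicative part of the ring record underlying a module record is irrelevant to
   the vector space structure.  The translate by U in the scalar multiplication is needed
   for c = 0, where the pointwise multiple of a coset is just {0} and not U. *)
definition quotient_space ::
    "('a, 'b, 'm) module_scheme \<Rightarrow> 'b set \<Rightarrow> ('a, 'b set) module" where
  "quotient_space V U =
     \<lparr>carrier = a_rcosets\<^bsub>V\<^esub> U, mult = undefined, one = undefined,
      zero = U, add = (<+>\<^bsub>V\<^esub>),
      smult = (\<lambda>c A. U <+>\<^bsub>V\<^esub> ((\<lambda>x. c \<odot>\<^bsub>V\<^esub> x) ` A))\<rparr>"

lemma quotient_space_is_vectorspace: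
  assumes sub: "VectorSpace.subspace F U V"
  shows "vectorspace F (quotient_space V U)"
proof -
  interpret vectorspace F V using sub by (simp add: VectorSpace.subspace_def)
  interpret U: LinearCombinations.submodule F U V using sub by (simp add: VectorSpace.subspace_def)
  have neg: "\<ominus>\<^bsub>V\<^esub> x \<in> U" if "x \<in> U" for x
  proof -
    have x: "x \<in> carrier V" using that U.subset by auto
    have "(\<ominus>\<^bsub>F\<^esub> \<one>\<^bsub>F\<^esub>) \<odot>\<^bsub>V\<^esub> x \<in> U" using that by simp
    then show ?thesis using x smult_minus_1[OF x] by simp
  qed
  have "subgroup U (add_monoid V)"
  proof (rule add.subgroupI)
    show "U \<noteq> {}" using U.zero_closed by blast
  qed (use U.subset neg in auto)
  then interpret S: additive_subgroup U V by (rule additive_subgroup.intro)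
  interpret S: abelian_subgroup U V
    by (rule abelian_subgroupI3) (unfold_locales)
  have rc: "A \<in> a_rcosets\<^bsub>V\<^esub> U \<longleftrightarrow> (\<exists>x\<in>carrier V. A = U +>\<^bsub>V\<^esub> x)" for A
    by (auto simp: A_RCOSETS_def')
  have sm: "U <+>\<^bsub>V\<^esub> ((\<lambda>x. c \<odot>\<^bsub>V\<^esub> x) ` (U +>\<^bsub>V\<^esub> x)) = U +>\<^bsub>V\<^esub> (c \<odot>\<^bsub>V\<^esub> x)"
    if c: "c \<in> carrier F" and x: "x \<in> carrier V" for c x
  proof (intro equalityI subsetI)
    fix y assume "y \<in> U <+>\<^bsub>V\<^esub> ((\<lambda>x. c \<odot>\<^bsub>V\<^esub> x) ` (U +>\<^bsub>V\<^esub> x))"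
    then obtain u w where u: "u \<in> U" "w \<in> U" "y = u \<oplus>\<^bsub>V\<^esub> c \<odot>\<^bsub>V\<^esub> (w \<oplus>\<^bsub>V\<^esub> x)"
      by (auto simp: set_add_def' a_r_coset_def')
    have cw: "c \<odot>\<^bsub>V\<^esub> w \<in> U" using u c by simp
    have car: "u \<in> carrier V" "w \<in> carrier V" "c \<odot>\<^bsub>V\<^esub> w \<in> carrier V"
      using u cw U.subset by auto
    have "y = (u \<oplus>\<^bsub>V\<^esub> c \<odot>\<^bsub>V\<^esub> w) \<oplus>\<^bsub>V\<^esub> c \<odot>\<^bsub>V\<^esub> x"
      using u c x car by (simp add: smult_r_distr a_assoc)
    then show "y \<in> U +>\<^bsub>V\<^esub> (c \<odot>\<^bsub>V\<^esub> x)"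
      using u cw by (auto simp: a_r_coset_def')
  next
    fix y assume "y \<in> U +>\<^bsub>V\<^esub> (c \<odot>\<^bsub>V\<^esub> x)"
    then obtain u where u: "u \<in> U" "y = u \<oplus>\<^bsub>V\<^esub> c \<odot>\<^bsub>V\<^esub> x"
      by (auto simp: a_r_coset_def')
    have "x = \<zero>\<^bsub>V\<^esub> \<oplus>\<^bsub>V\<^esub> x" using x by simp
    then have "x \<in> U +>\<^bsub>V\<^esub> x" using U.zero_closed by (auto simp: a_r_coset_def' simp del: l_zero)
    then show "y \<in> U <+>\<^bsub>V\<^esub> ((\<lambda>x. c \<odot>\<^bsub>V\<^esub> x) ` (U +>\<^bsub>V\<^esub> x))"
      using u by (auto simp: set_add_def')
  qed
  have ad: "(U +>\<^bsub>V\<^esub> x) <+>\<^bsub>V\<^esub> (U +>\<^bsub>V\<^esub> y) = U +>\<^bsub>V\<^esub> (x \<oplus>\<^bsub>V\<^esub> y)"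
    if "x \<in> carrier V" "y \<in> carrier V" for x y
    using that by (rule S.a_rcos_sum)
  have z: "U = U +>\<^bsub>V\<^esub> \<zero>\<^bsub>V\<^esub>"
    using U.subset by (simp add: a_coset_add_zero)
  have ag: "abelian_group (quotient_space V U)"
  proof (rule abelian_groupI, goal_cases)
    case (1 x y) then show ?case by (auto simp: quotient_space_def rc ad)
  next
    case 2 then show ?case using z by (auto simp: quotient_space_def rc)
  next
    case (3 x y z) then show ?case by (auto simp: quotient_space_def rc ad a_assoc)
  next
    case (4 x y) then show ?case by (auto simp: quotient_space_def rc ad a_comm)
  next
    case (5 x) 
    then obtain a where a: "a \<in> carrier V" "x = U +>\<^bsub>V\<^esub> a" by (auto simp: quotient_space_def rc)
    have "(U +>\<^bsub>V\<^esub> \<zero>\<^bsub>V\<^esub>) <+>\<^bsub>V\<^esub> (U +>\<^bsub>V\<^esub> a) = U +>\<^bsub>V\<^esub> a" using a by (subst ad) auto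
    then show ?case using a z by (simp add: quotient_space_def)
  next
    case (6 x)
    then obtain a where a: "a \<in> carrier V" "x = U +>\<^bsub>V\<^esub> a" by (auto simp: quotient_space_def rc)
    have "(U +>\<^bsub>V\<^esub> (\<ominus>\<^bsub>V\<^esub> a)) <+>\<^bsub>V\<^esub> (U +>\<^bsub>V\<^esub> a) = U" using a z by (subst ad) (auto simp: l_neg)
    moreover have "U +>\<^bsub>V\<^esub> (\<ominus>\<^bsub>V\<^esub> a) \<in> a_rcosets\<^bsub>V\<^esub> U" using a by (auto simp: rc)
    ultimately show ?case using a by (auto simp: quotient_space_def)
  qed
  have "module F (quotient_space V U)"
    by (rule moduleI)
       (use ag in \<open>auto simp: is_cring quotient_space_def rc ad sm smult_l_distr smult_r_distr smult_assoc1\<close>)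
  then show ?thesis
    by (simp add: vectorspace_def field_axioms)
qed

definition quotient_subspace ::
    "('a, 'b, 'm) module_scheme \<Rightarrow> 'b set \<Rightarrow> 'b set \<Rightarrow> 'b set set" where
  "quotient_subspace V W U = (\<lambda>x. U +>\<^bsub>V\<^esub> x) ` W"

definition grassmannian ::
    "('a, 'r) ring_scheme \<Rightarrow> ('a, 'b, 'm) module_scheme \<Rightarrow> nat \<Rightarrow> 'b set set" where
  "grassmannian F W j =
     {X. VectorSpace.subspace F X W \<and>
         vectorspace.fin_dim F (W\<lparr>carrier := X\<rparr>) \<and>
         vectorspace.dim F (W\<lparr>carrier := X\<rparr>) = j}"

(* The size of the set of b-dimensional subspaces of an a-dimensional space over F.  It
   depends on neither the choice of that space, here the coordinate space F^a, nor, beyond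
   its cardinality q, on the finite field F. *)
definition gaussian_binomial :: "('a, 'r) ring_scheme \<Rightarrow> nat \<Rightarrow> nat \<Rightarrow> nat" where
  "gaussian_binomial F a b = card (grassmannian F (ring.func_space F {..<a}) b)"

definition avoids_factor :: "'b set \<Rightarrow> 'b set \<Rightarrow> 'b set \<Rightarrow> bool" where
  "avoids_factor U\<^sub>1 U\<^sub>2 K \<longleftrightarrow> U\<^sub>1 \<inter> K = U\<^sub>2 \<inter> K"

(* The last argument is K2, standing for K2/U2. *)
definition avoiding_join ::
    "('a, 'r) ring_scheme \<Rightarrow> ('a, 'b, 'm) module_scheme \<Rightarrow> 'b set \<Rightarrow> 'b set \<Rightarrow>
     'b set \<Rightarrow> 'b set \<Rightarrow> 'b set set" where
  "avoiding_join F V U\<^sub>1 U\<^sub>2 K\<^sub>1 K\<^sub>2 =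
     {K. VectorSpace.subspace F K V \<and> U\<^sub>1 \<inter> K = K\<^sub>1 \<and> U\<^sub>2 <+>\<^bsub>V\<^esub> K = K\<^sub>2 \<and>
         avoids_factor U\<^sub>1 U\<^sub>2 K}"

definition avoiding_join_sets ::
    "('a, 'r) ring_scheme \<Rightarrow> ('a, 'b, 'm) module_scheme \<Rightarrow> 'b set \<Rightarrow> 'b set \<Rightarrow>
     'b set set \<Rightarrow> 'b set set set \<Rightarrow> 'b set set" where
  "avoiding_join_sets F V U\<^sub>1 U\<^sub>2 \<B>\<^sub>1 \<B>\<^sub>2 =
     (\<Union>B\<in>\<B>\<^sub>1. \<Union>K\<^sub>2\<in>{K\<^sub>2. VectorSpace.subspace F K\<^sub>2 V \<and> U\<^sub>2 \<subseteq> K\<^sub>2 \<and>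
                               quotient_subspace V K\<^sub>2 U\<^sub>2 \<in> \<B>\<^sub>2}.
        avoiding_join F V U\<^sub>1 U\<^sub>2 B K\<^sub>2)"

end

theory Submission
  imports Defs
begin

text \<open>
  Over a field of size q a subspace has dimension d iff it has cardinality q^d, so all dimension
  arguments become counting arguments. For the decomposition, let f j = dim (U j \<inter> X) where
  dim X = k: along the chain f is monotone and grows by at most 1 per step, and f is bounded by k.
  Hence there is exactly one i \<le> k with f (s + i) = i = f (s + i + 1), namely the last i \<le> k with
  i \<le> f (s + i).

  The counting rests on a single fact: if H is a hyperplane of W and L \<le> H, then the number of X \<le> W
  not contained in H with X \<inter> H = L is card H / card L, because the sets X - L partition W - H.
  It yields both the q-Pascal recursion for the number of subspaces between two given ones and,
  by induction, the number of relative complements, that is, the size of an avoiding join.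
\<close>

section \<open>Fibre counting and slowly growing integer sequences\<close>

text \<open>The fibres of \<open>g\<close> over \<open>R\<close> partition \<open>S\<close>. The
  maps counted this way below are addition of pairs, the coset map, intersection with a hyperplane,
  and the two projections of an avoiding join.\<close>

lemma card_eq_card_times_fiber:
  fixes k :: nat
  assumes "finite S" "finite R" "g ` S \<subseteq> R" "\<And>y. y \<in> R \<Longrightarrow> card {x \<in> S. g x = y} = k"
  shows "card S = card R * k"
proof -
  have "card S = (\<Sum>x\<in>S. (\<lambda>_. 1) (g x))" by simp
  also have "\<dots> = (\<Sum>y\<in>R. of_nat (card {x \<in> S. g x = y}) * (\<lambda>_. 1) y)"
    by (rule sum_fun_comp) (use assms in auto)
  also have "\<dots> = card R * k" using assms(4) by simp
  finally show ?thesis .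
qed

lemma le_of_strict_increasing:
  fixes d :: "nat \<Rightarrow> nat"
  assumes "\<And>i. i < v \<Longrightarrow> d i < d (Suc i)" "i \<le> j" "j \<le> v"
  shows "d i + (j - i) \<le> d j"
  using assms(2,3)
proof (induction j rule: dec_induct)
  case (step n)
  then show ?case using assms(1)[of n] by simp
qed simp

text \<open>Starting from the value \<open>i\<close> at \<open>s + i + 1\<close>, steps of at most
  one reach at most \<open>i' - 1\<close> at \<open>s + i'\<close>, which is one short of
  \<open>i'\<close>.\<close>

lemma diagonal_unique:
  fixes f :: "nat \<Rightarrow> nat"
  assumes step: "\<And>j. s \<le> j \<Longrightarrow> j < s + k + 1 \<Longrightarrow> f (Suc j) \<le> Suc (f j)"
    and "i < i'" "i' \<le> k" "f (s + i + 1) = i" "f (s + i') = i'"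
  shows False
proof -
  have "f (s + i') \<le> f (s + i + 1) + (i' - (i + 1))" if "i + 1 \<le> i'" "i' \<le> k" for i'
    using that
  proof (induction i' rule: dec_induct)
    case (step n)
    then show ?case using assms(1)[of "s + n"] by simp
  qed simp
  from this[of i'] show False using assms by simp
qed

text \<open>For b > a the truncated exponent a - b is harmless, since then q_binomial q a b = 0.\<close>

fun q_binomial :: "nat \<Rightarrow> nat \<Rightarrow> nat \<Rightarrow> nat" where
  "q_binomial q a 0 = 1"
| "q_binomial q 0 (Suc b) = 0"
| "q_binomial q (Suc a) (Suc b) = q_binomial q a (Suc b) + q_binomial q a b * q ^ (a - b)"

section \<open>Subspaces, their sums, and lines\<close>

context vectorspace
begin

abbreviation sub where "sub W \<equiv> VectorSpace.subspace K W V"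

lemma subI:
  assumes "W \<subseteq> carrier V" "\<zero>\<^bsub>V\<^esub> \<in> W"
    "\<And>x y. x \<in> W \<Longrightarrow> y \<in> W \<Longrightarrow> x \<oplus>\<^bsub>V\<^esub> y \<in> W"
    "\<And>c x. c \<in> carrier K \<Longrightarrow> x \<in> W \<Longrightarrow> c \<odot>\<^bsub>V\<^esub> x \<in> W"
  shows "sub W"
  using assms module_axioms vectorspace_axioms
  by (auto simp: VectorSpace.subspace_def LinearCombinations.submodule_def)

lemma subD:
  assumes "sub W"
  shows sub_subset: "W \<subseteq> carrier V" and sub_zero: "\<zero>\<^bsub>V\<^esub> \<in> W"
    and sub_add: "\<And>x y. x \<in> W \<Longrightarrow> y \<in> W \<Longrightarrow> x \<oplus>\<^bsub>V\<^esub> y \<in> W"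
    and sub_smult: "\<And>c x. c \<in> carrier K \<Longrightarrow> x \<in> W \<Longrightarrow> c \<odot>\<^bsub>V\<^esub> x \<in> W"
  using assms by (auto simp: VectorSpace.subspace_def LinearCombinations.submodule_def)

lemma sub_carrier: "sub W \<Longrightarrow> x \<in> W \<Longrightarrow> x \<in> carrier V"
  using sub_subset by blast

lemma sub_neg:
  assumes "sub W" "x \<in> W"
  shows "\<ominus>\<^bsub>V\<^esub> x \<in> W"
  using sub_smult[OF assms(1) _ assms(2), of "\<ominus>\<^bsub>K\<^esub> \<one>\<^bsub>K\<^esub>"] sub_carrier[OF assms]
  by (simp add: smult_minus_1)

lemma sub_minus: "sub W \<Longrightarrow> x \<in> W \<Longrightarrow> y \<in> W \<Longrightarrow> x \<ominus>\<^bsub>V\<^esub> y \<in> W"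
  by (simp add: a_minus_def sub_add sub_neg)

lemma sub_inter: "sub A \<Longrightarrow> sub B \<Longrightarrow> sub (A \<inter> B)"
  by (rule subI) (auto intro: sub_carrier sub_zero sub_add sub_smult)

lemma sub_self: "sub (carrier V)"
  by (rule subI) auto

lemma sub_zero_space: "sub {\<zero>\<^bsub>V\<^esub>}"
  by (rule subI) auto

lemma mem_set_add: "x \<in> A <+>\<^bsub>V\<^esub> B \<longleftrightarrow> (\<exists>a\<in>A. \<exists>b\<in>B. x = a \<oplus>\<^bsub>V\<^esub> b)"
  by (auto simp: set_add_def')

lemma set_addI: "a \<in> A \<Longrightarrow> b \<in> B \<Longrightarrow> a \<oplus>\<^bsub>V\<^esub> b \<in> A <+>\<^bsub>V\<^esub> B"
  by (auto simp: mem_set_add)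

lemma sub_set_add:
  assumes "sub A" "sub B"
  shows "sub (A <+>\<^bsub>V\<^esub> B)"
proof -
  have "A <+>\<^bsub>V\<^esub> B = subspace_sum A B"
    unfolding submodule_sum_def set_add_def' by (auto simp: image_iff)
  then show ?thesis using sum_is_subspace[OF assms] by simp
qed

lemma subset_set_add:
  assumes "sub A" "sub B"
  shows "A \<subseteq> A <+>\<^bsub>V\<^esub> B" "B \<subseteq> A <+>\<^bsub>V\<^esub> B"
proof -
  show "A \<subseteq> A <+>\<^bsub>V\<^esub> B"
  proof
    fix x assume "x \<in> A"
    then show "x \<in> A <+>\<^bsub>V\<^esub> B"
      unfolding mem_set_add using sub_zero[OF assms(2)] sub_carrier[OF assms(1)]
      by (intro bexI[of _ x] bexI[of _ "\<zero>\<^bsub>V\<^esub>"]) auto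
  qed
  show "B \<subseteq> A <+>\<^bsub>V\<^esub> B"
  proof
    fix x assume "x \<in> B"
    then show "x \<in> A <+>\<^bsub>V\<^esub> B"
      unfolding mem_set_add using sub_zero[OF assms(1)] sub_carrier[OF assms(2)]
      by (intro bexI[of _ x] bexI[of _ "\<zero>\<^bsub>V\<^esub>"]) auto
  qed
qed

lemma set_add_subset:
  assumes "sub W" "A \<subseteq> W" "B \<subseteq> W"
  shows "A <+>\<^bsub>V\<^esub> B \<subseteq> W"
  using assms(2,3) by (auto simp: mem_set_add intro!: sub_add[OF assms(1)])

lemma add_minus_assoc:
  assumes "a \<in> carrier V" "b \<in> carrier V"
  shows "a \<oplus>\<^bsub>V\<^esub> (b \<ominus>\<^bsub>V\<^esub> a) = b"
  using assms by (metis M.add.inv_closed M.add.m_assoc M.add.m_comm M.r_neg M.r_zero a_minus_def)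

lemma add_minus_cancel:
  assumes "a \<in> carrier V" "b \<in> carrier V"
  shows "(a \<oplus>\<^bsub>V\<^esub> b) \<ominus>\<^bsub>V\<^esub> a = b"
  using assms by (metis M.add.inv_closed M.add.m_assoc M.add.m_comm M.r_neg M.r_zero a_minus_def)

text \<open>The span of \<open>c\<close>, written as an image of the scalars so that its size
  follows from injectivity of scaling when \<open>c\<close> is nonzero.\<close>

definition line where "line c = (\<lambda>a. a \<odot>\<^bsub>V\<^esub> c) ` carrier K"

lemma sub_line:
  assumes "c \<in> carrier V"
  shows "sub (line c)"
proof (rule subI)
  show "\<zero>\<^bsub>V\<^esub> \<in> line c" unfolding line_def using assms by (intro image_eqI[of _ _ "\<zero>\<^bsub>K\<^esub>"]) auto
  fix x y assume "x \<in> line c" "y \<in> line c"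
  then obtain a b where "a \<in> carrier K" "b \<in> carrier K" "x = a \<odot>\<^bsub>V\<^esub> c" "y = b \<odot>\<^bsub>V\<^esub> c"
    unfolding line_def by auto
  then show "x \<oplus>\<^bsub>V\<^esub> y \<in> line c"
    unfolding line_def using assms by (intro image_eqI[of _ _ "a \<oplus>\<^bsub>K\<^esub> b"]) (auto simp: smult_l_distr)
next
  fix d x assume "d \<in> carrier K" "x \<in> line c"
  then obtain a where "a \<in> carrier K" "x = a \<odot>\<^bsub>V\<^esub> c" unfolding line_def by auto
  then show "d \<odot>\<^bsub>V\<^esub> x \<in> line c"
    unfolding line_def using assms \<open>d \<in> carrier K\<close>
    by (intro image_eqI[of _ _ "d \<otimes>\<^bsub>K\<^esub> a"]) (auto simp: smult_assoc1)
qed (use assms in \<open>auto simp: line_def\<close>)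

lemma self_in_line: "c \<in> carrier V \<Longrightarrow> c \<in> line c"
  unfolding line_def by (intro image_eqI[of _ _ "\<one>\<^bsub>K\<^esub>"]) auto

lemma line_subset: "sub W \<Longrightarrow> c \<in> W \<Longrightarrow> line c \<subseteq> W"
  unfolding line_def using sub_smult by blast

text \<open>Scaling back by the inverse of \<open>a\<close>. The main use is the contrapositive: if
  \<open>c\<close> lies outside \<open>W\<close>, then a multiple of \<open>c\<close> in
  \<open>W\<close> must have scalar zero.\<close>

lemma smult_mem_iff:
  assumes "sub W" "c \<in> carrier V" "a \<in> carrier K" "a \<noteq> \<zero>\<^bsub>K\<^esub>" "a \<odot>\<^bsub>V\<^esub> c \<in> W"
  shows "c \<in> W"
proof -
  have "c = inv\<^bsub>K\<^esub> a \<odot>\<^bsub>V\<^esub> (a \<odot>\<^bsub>V\<^esub> c)" using mult_inverse[OF assms(3,2) refl assms(4)] .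
  moreover have "inv\<^bsub>K\<^esub> a \<in> carrier K" using assms by auto
  ultimately show ?thesis using sub_smult[OF assms(1) _ assms(5)] by metis
qed

text \<open>An instance of the modular law: since \<open>L\<close> is contained in \<open>H\<close>,
  the intersection is \<open>L\<close> plus the part of \<open>line c\<close> inside
  \<open>H\<close>, and that part is zero.\<close>

lemma set_add_line_inter:
  assumes "sub H" "L \<subseteq> H" "c \<in> carrier V" "c \<notin> H" "sub L"
  shows "(L <+>\<^bsub>V\<^esub> line c) \<inter> H = L"
proof
  show "L \<subseteq> (L <+>\<^bsub>V\<^esub> line c) \<inter> H"
    using subset_set_add(1)[OF assms(5) sub_line[OF assms(3)]] assms(2) by auto
  show "(L <+>\<^bsub>V\<^esub> line c) \<inter> H \<subseteq> L"
  proof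
    fix x assume "x \<in> (L <+>\<^bsub>V\<^esub> line c) \<inter> H"
    then obtain l a where x: "x \<in> H" "l \<in> L" "a \<in> carrier K" "x = l \<oplus>\<^bsub>V\<^esub> a \<odot>\<^bsub>V\<^esub> c"
      by (auto simp: mem_set_add line_def)
    have "l \<in> carrier V" using x sub_carrier assms by blast
    then have "a \<odot>\<^bsub>V\<^esub> c = x \<ominus>\<^bsub>V\<^esub> l"
      using x assms by (metis M.add.m_comm M.add.inv_solve_right M.add.m_closed a_minus_def smult_closed)
    then have "a \<odot>\<^bsub>V\<^esub> c \<in> H" using sub_minus[OF assms(1) x(1), of l] x(2) assms(2) by (metis subsetD)
    then have "a = \<zero>\<^bsub>K\<^esub>" using smult_mem_iff assms x by blast
    then show "x \<in> L" using x \<open>l \<in> carrier V\<close> assms by simp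
  qed
qed

text \<open>Coordinates with respect to a basis are unique. Extensional coefficient functions are
  used so that functions differing only outside \<open>B\<close> are not counted twice.\<close>

lemma bij_betw_lincomb:
  assumes "finite B" "basis B"
  shows "bij_betw (\<lambda>a. lincomb a B) (B \<rightarrow>\<^sub>E carrier K) (carrier V)"
proof (rule bij_betw_imageI)
  have "B \<subseteq> carrier V" using assms by (simp add: basis_def)
  then have ex: "\<forall>v. v \<in> carrier V \<longrightarrow> (\<exists>!a. a \<in> B \<rightarrow>\<^sub>E carrier K \<and> lincomb a B = v)"
    using basis_criterion[OF assms(1)] assms(2) by blast
  have cl: "lincomb a B \<in> carrier V" if "a \<in> B \<rightarrow>\<^sub>E carrier K" for a
    using \<open>B \<subseteq> carrier V\<close> that by (intro lincomb_closed) (auto simp: PiE_def)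
  then show "inj_on (\<lambda>a. lincomb a B) (B \<rightarrow>\<^sub>E carrier K)"
    using ex by (intro inj_onI) metis
  show "(\<lambda>a. lincomb a B) ` (B \<rightarrow>\<^sub>E carrier K) = carrier V"
    using cl ex by (auto simp: image_iff)
qed

lemma finite_carrier_if_fin_dim:
  assumes "finite (carrier K)" "fin_dim"
  shows "finite (carrier V)"
proof -
  obtain B where B: "finite B" "basis B" using finite_basis_exists[OF assms(2)] by blast
  have "finite (B \<rightarrow>\<^sub>E carrier K)" using B(1) assms(1) by (simp add: finite_PiE)
  then show ?thesis using bij_betw_finite[OF bij_betw_lincomb[OF B]] by simp
qed

text \<open>Grassmannians of a subspace are formed in the structure with restricted carrier; this
  brings them back to subspaces of \<open>V\<close>.\<close>

lemma sub_restrict_iff: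
  assumes "sub W"
  shows "VectorSpace.subspace K X (V\<lparr>carrier := W\<rparr>) \<longleftrightarrow> sub X \<and> X \<subseteq> W"
  using assms subspace_is_vs[OF assms] module_axioms vectorspace_axioms
  by (auto simp: VectorSpace.subspace_def LinearCombinations.submodule_def vectorspace_def)

end

section \<open>Dimension as cardinality over a finite field\<close>

text \<open>Finiteness of the carrier is the standing assumption, because the arguments count
  vectors; \<open>card_carrier_dim\<close> recovers \<open>fin_dim\<close> from it.\<close>

locale finite_vectorspace = vectorspace +
  assumes finite_K: "finite (carrier K)" and finite_V: "finite (carrier V)"
begin

abbreviation "q \<equiv> card (carrier K)"

lemma q_gt_1: "1 < q"
proof -
  have "card {\<zero>\<^bsub>K\<^esub>, \<one>\<^bsub>K\<^esub>} \<le> q" using finite_K by (intro card_mono) auto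
  then show ?thesis by simp
qed

lemma finite_sub: "sub W \<Longrightarrow> finite W"
  using sub_subset finite_V finite_subset by blast

lemma finite_subs: "finite {W. sub W \<and> P W}"
  by (rule finite_subset[of _ "Pow (carrier V)"]) (use sub_subset finite_V in auto)

lemma card_sub_pos: "sub W \<Longrightarrow> 0 < card W"
  using finite_sub sub_zero by (auto simp: card_gt_0_iff)

text \<open>The carrier is itself a finite generating set, so a finite basis exists, and counting
  coordinate functions counts the vectors.\<close>

lemma card_carrier_dim: "fin_dim" "card (carrier V) = q ^ dim"
proof -
  have "gen_set (carrier V)"
    using in_own_span[of "carrier V"] span_is_subset2[of "carrier V"] by auto
  then show "fin_dim" unfolding fin_dim_def using finite_V by blast
  then obtain B where B: "finite B" "basis B" using finite_basis_exists by blast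
  show "card (carrier V) = q ^ dim"
    using bij_betw_same_card[OF bij_betw_lincomb[OF B]]
    by (simp add: card_PiE[OF B(1)] dim_basis[OF B])
qed

lemma finite_vectorspace_sub:
  assumes "sub W"
  shows "finite_vectorspace K (V\<lparr>carrier := W\<rparr>)"
  using subspace_is_vs[OF assms] finite_sub[OF assms] finite_K
  by (simp add: finite_vectorspace_def finite_vectorspace_axioms_def)

text \<open>The bridge from dimensions to cardinalities: since \<open>1 < q\<close>, the exponent of
  a power of \<open>q\<close> is determined by its value.\<close>

lemma dim_sub_iff:
  assumes "sub W"
  shows "vectorspace.fin_dim K (V\<lparr>carrier := W\<rparr>)"
    and "vectorspace.dim K (V\<lparr>carrier := W\<rparr>) = d \<longleftrightarrow> card W = q ^ d"
proof -
  interpret W: finite_vectorspace K "V\<lparr>carrier := W\<rparr>" by (rule finite_vectorspace_sub[OF assms])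
  show "W.fin_dim" by (rule W.card_carrier_dim)
  show "W.dim = d \<longleftrightarrow> card W = q ^ d"
    using W.card_carrier_dim(2) q_gt_1 by auto
qed

lemma card_sub_eq_power: "sub W \<Longrightarrow> \<exists>d. card W = q ^ d"
  using dim_sub_iff(2) by blast

lemma grassmannian_restrict:
  assumes "sub W"
  shows "grassmannian K (V\<lparr>carrier := W\<rparr>) j = {X. sub X \<and> X \<subseteq> W \<and> card X = q ^ j}"
  using dim_sub_iff by (auto simp: grassmannian_def sub_restrict_iff[OF assms])

lemma grassmannian_eq: "grassmannian K V j = {X. sub X \<and> card X = q ^ j}"
  using dim_sub_iff by (auto simp: grassmannian_def)

text \<open>The dimension formula in multiplicative form. Addition maps pairs onto the sum, and once
  one representation \<open>w = a + b\<close> is fixed, all others are \<open>(a + d, b - d)\<close>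
  with \<open>d\<close> in the intersection.\<close>

lemma card_set_add:
  assumes "sub A" "sub B"
  shows "card A * card B = card (A <+>\<^bsub>V\<^esub> B) * card (A \<inter> B)"
proof -
  have "card (A \<times> B) = card (A <+>\<^bsub>V\<^esub> B) * card (A \<inter> B)"
  proof (rule card_eq_card_times_fiber[where g = "\<lambda>(a, b). a \<oplus>\<^bsub>V\<^esub> b"])
    show "finite (A \<times> B)" "finite (A <+>\<^bsub>V\<^esub> B)"
      using assms finite_sub sub_set_add by auto
    show "(\<lambda>(a, b). a \<oplus>\<^bsub>V\<^esub> b) ` (A \<times> B) \<subseteq> A <+>\<^bsub>V\<^esub> B"
      by (auto intro: set_addI)
    fix w assume "w \<in> A <+>\<^bsub>V\<^esub> B"
    then obtain a b where ab: "a \<in> A" "b \<in> B" "w = a \<oplus>\<^bsub>V\<^esub> b" by (auto simp: mem_set_add)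
    have c: "a \<in> carrier V" "b \<in> carrier V" using ab assms sub_carrier by auto
    have "bij_betw (\<lambda>d. (a \<oplus>\<^bsub>V\<^esub> d, b \<ominus>\<^bsub>V\<^esub> d)) (A \<inter> B)
        {x \<in> A \<times> B. (case x of (a, b) \<Rightarrow> a \<oplus>\<^bsub>V\<^esub> b) = w}"
    proof (rule bij_betwI[where g = "\<lambda>(x, y). x \<ominus>\<^bsub>V\<^esub> a"])
      show "(\<lambda>d. (a \<oplus>\<^bsub>V\<^esub> d, b \<ominus>\<^bsub>V\<^esub> d))
          \<in> A \<inter> B \<rightarrow> {x \<in> A \<times> B. (case x of (a, b) \<Rightarrow> a \<oplus>\<^bsub>V\<^esub> b) = w}"
      proof
        fix d assume d: "d \<in> A \<inter> B"
        have dc: "d \<in> carrier V" using d assms sub_carrier by auto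
        have "(a \<oplus>\<^bsub>V\<^esub> d) \<oplus>\<^bsub>V\<^esub> (b \<ominus>\<^bsub>V\<^esub> d) = a \<oplus>\<^bsub>V\<^esub> (d \<oplus>\<^bsub>V\<^esub> (b \<ominus>\<^bsub>V\<^esub> d))"
          using c dc by (intro M.a_assoc) auto
        then show "(a \<oplus>\<^bsub>V\<^esub> d, b \<ominus>\<^bsub>V\<^esub> d) \<in> {x \<in> A \<times> B. (case x of (a, b) \<Rightarrow> a \<oplus>\<^bsub>V\<^esub> b) = w}"
          using d ab c dc sub_add[OF assms(1)] sub_minus[OF assms(2)] by (auto simp: add_minus_assoc)
      qed
      show "(\<lambda>(x, y). x \<ominus>\<^bsub>V\<^esub> a)
          \<in> {x \<in> A \<times> B. (case x of (a, b) \<Rightarrow> a \<oplus>\<^bsub>V\<^esub> b) = w} \<rightarrow> A \<inter> B"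
      proof
        fix p assume p: "p \<in> {x \<in> A \<times> B. (case x of (a, b) \<Rightarrow> a \<oplus>\<^bsub>V\<^esub> b) = w}"
        obtain x y where pe: "p = (x, y)" by (cases p)
        have xy: "x \<in> A" "y \<in> B" "x \<oplus>\<^bsub>V\<^esub> y = w" using p by (auto simp: pe)
        have xc: "x \<in> carrier V" "y \<in> carrier V" using xy assms sub_carrier by auto
        \<comment> \<open>From \<open>x + y = a + b\<close> one gets \<open>x - a = b - y\<close>;
          the left side lies in \<open>A\<close>, the right side in \<open>B\<close>, so the
          difference lies in both.\<close>
        have "x = (y \<oplus>\<^bsub>V\<^esub> x) \<ominus>\<^bsub>V\<^esub> y"
          using xc by (simp add: add_minus_cancel)
        also have "\<dots> = a \<oplus>\<^bsub>V\<^esub> (b \<ominus>\<^bsub>V\<^esub> y)"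
          using xy(3) ab(3) c xc by (simp add: M.a_comm[of y x] a_minus_def M.a_assoc)
        finally have "x \<ominus>\<^bsub>V\<^esub> a = b \<ominus>\<^bsub>V\<^esub> y"
          using c xc by (simp add: add_minus_cancel)
        then show "(case p of (x, y) \<Rightarrow> x \<ominus>\<^bsub>V\<^esub> a) \<in> A \<inter> B"
          using sub_minus[OF assms(1) xy(1) ab(1)] sub_minus[OF assms(2) ab(2) xy(2)]
          by (simp add: pe)
      qed
    next
      fix d assume "d \<in> A \<inter> B"
      then have "d \<in> carrier V" using assms sub_carrier by auto
      then show "(case (a \<oplus>\<^bsub>V\<^esub> d, b \<ominus>\<^bsub>V\<^esub> d) of (x, y) \<Rightarrow> x \<ominus>\<^bsub>V\<^esub> a) = d"
        using c by (simp add: add_minus_cancel)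
    next
      fix p assume p: "p \<in> {x \<in> A \<times> B. (case x of (a, b) \<Rightarrow> a \<oplus>\<^bsub>V\<^esub> b) = w}"
      obtain x y where pe: "p = (x, y)" by (cases p)
      have xy: "x \<in> carrier V" "y \<in> carrier V" "x \<oplus>\<^bsub>V\<^esub> y = a \<oplus>\<^bsub>V\<^esub> b"
        using p ab assms sub_carrier by (auto simp: pe)
      have "b \<ominus>\<^bsub>V\<^esub> (x \<ominus>\<^bsub>V\<^esub> a) = (a \<oplus>\<^bsub>V\<^esub> b) \<ominus>\<^bsub>V\<^esub> x"
        using c xy(1) by (simp add: a_minus_def M.a_ac M.minus_add)
      also have "\<dots> = y"
        using xy by (metis add_minus_cancel)
      finally show "(\<lambda>d. (a \<oplus>\<^bsub>V\<^esub> d, b \<ominus>\<^bsub>V\<^esub> d)) (case p of (x, y) \<Rightarrow> x \<ominus>\<^bsub>V\<^esub> a) = p"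
        using c xy by (simp add: pe add_minus_assoc)
    qed
    then show "card {x \<in> A \<times> B. (case x of (a, b) \<Rightarrow> a \<oplus>\<^bsub>V\<^esub> b) = w} = card (A \<inter> B)"
      by (rule bij_betw_same_card[symmetric])
  qed
  then show ?thesis by (simp add: card_cartesian_product)
qed

lemma card_line:
  assumes "c \<in> carrier V" "c \<noteq> \<zero>\<^bsub>V\<^esub>"
  shows "card (line c) = q"
  unfolding line_def
proof (rule card_image, rule inj_onI)
  fix a b assume ab: "a \<in> carrier K" "b \<in> carrier K" "a \<odot>\<^bsub>V\<^esub> c = b \<odot>\<^bsub>V\<^esub> c"
  have "(a \<ominus>\<^bsub>K\<^esub> b) \<odot>\<^bsub>V\<^esub> c = \<zero>\<^bsub>V\<^esub>"
    using ab assms(1) by (simp add: a_minus_def smult_l_distr smult_l_minus M.r_neg)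
  then have "a \<ominus>\<^bsub>K\<^esub> b = \<zero>\<^bsub>K\<^esub>"
    using smult_mem_iff[OF sub_zero_space assms(1), of "a \<ominus>\<^bsub>K\<^esub> b"] ab assms(2) by auto
  then show "a = b" using ab by simp
qed

text \<open>The line meets \<open>L\<close> only in zero, so the dimension formula multiplies the
  size by that of the line.\<close>

lemma card_add_line:
  assumes "sub L" "c \<in> carrier V" "c \<notin> L"
  shows "card (L <+>\<^bsub>V\<^esub> line c) = q * card L"
proof -
  have "c \<noteq> \<zero>\<^bsub>V\<^esub>" using assms sub_zero by auto
  have "L \<inter> line c = {\<zero>\<^bsub>V\<^esub>}"
  proof -
    have "x = \<zero>\<^bsub>V\<^esub>" if x: "x \<in> L" "x \<in> line c" for x
    proof -
      obtain a where a: "a \<in> carrier K" "x = a \<odot>\<^bsub>V\<^esub> c" using x(2) unfolding line_def by auto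
      then have "a = \<zero>\<^bsub>K\<^esub>" using smult_mem_iff[OF assms(1,2) a(1)] x(1) assms(3) by blast
      then show ?thesis using a assms(2) by simp
    qed
    then show ?thesis using sub_zero[OF assms(1)] sub_zero[OF sub_line[OF assms(2)]] by blast
  qed
  then show ?thesis
    using card_set_add[OF assms(1) sub_line[OF assms(2)]] card_line[OF assms(2) \<open>c \<noteq> \<zero>\<^bsub>V\<^esub>\<close>]
    by (simp add: mult.commute)
qed

section \<open>Hyperplanes and extensions over them\<close>

text \<open>Take \<open>H\<close> maximal among the proper subspaces of \<open>W\<close> above
  \<open>U\<close>. Adding the line of any vector of \<open>W\<close> outside \<open>H\<close> gives
  all of \<open>W\<close> by maximality, so the index is \<open>q\<close>. From here on, being a
  hyperplane is expressed by this index.\<close>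

lemma exists_hyperplane:
  assumes "sub U" "sub W" "U \<subset> W"
  obtains H where "sub H" "U \<subseteq> H" "H \<subset> W" "card W = q * card H"
proof -
  let ?S = "{H. sub H \<and> U \<subseteq> H \<and> H \<subset> W}"
  have "finite ?S" "?S \<noteq> {}" using finite_subs[of "\<lambda>H. U \<subseteq> H \<and> H \<subset> W"] assms by auto
  then obtain H where H: "H \<in> ?S" and "\<forall>X\<in>?S. H \<subseteq> X \<longrightarrow> H = X"
    using finite_has_maximal[of ?S] by meson
  then have max: "\<And>X. X \<in> ?S \<Longrightarrow> H \<subseteq> X \<Longrightarrow> H = X" by blast
  obtain c where c: "c \<in> W" "c \<notin> H" using H by auto
  have cV: "c \<in> carrier V" using c assms sub_carrier by blast
  have sH: "sub H" using H by simp
  let ?X = "H <+>\<^bsub>V\<^esub> line c"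
  have X: "sub ?X" "H \<subseteq> ?X" "c \<in> ?X" "?X \<subseteq> W"
    using sub_set_add subset_set_add[OF sH sub_line[OF cV]] sub_line[OF cV] self_in_line[OF cV] sH H
      line_subset[OF assms(2) c(1)] set_add_subset[OF assms(2), of H "line c"] by auto
  have "?X = W" using max[of ?X] X H c by auto
  then show thesis using that[of H] H card_add_line[OF sH cV c(2)] by auto
qed

text \<open>A vector of \<open>X\<close> outside \<open>H\<close> already spans \<open>W\<close>
  together with \<open>H\<close>, so \<open>H + X = W\<close> and the dimension formula gives the
  size.\<close>

lemma card_eq_if_not_in_hyperplane:
  assumes "sub H" "sub W" "H \<subseteq> W" "card W = q * card H" "sub X" "X \<subseteq> W" "\<not> X \<subseteq> H"
  shows "card X = q * card (X \<inter> H)"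
proof -
  obtain c where c: "c \<in> X" "c \<notin> H" using assms by auto
  have cV: "c \<in> carrier V" using c assms sub_carrier by blast
  have "H <+>\<^bsub>V\<^esub> line c \<subseteq> H <+>\<^bsub>V\<^esub> X"
    using line_subset[OF assms(5) c(1)] unfolding mem_set_add subset_iff by blast
  then have "card W \<le> card (H <+>\<^bsub>V\<^esub> X)"
    using card_add_line[OF assms(1) cV c(2)] assms finite_sub sub_set_add by (metis card_mono)
  moreover have "H <+>\<^bsub>V\<^esub> X \<subseteq> W" using set_add_subset assms by blast
  ultimately have "card (H <+>\<^bsub>V\<^esub> X) = card W"
    using finite_sub assms by (metis card_mono le_antisym)
  then have "card H * card X = q * card H * card (H \<inter> X)"
    using card_set_add[OF assms(1,5)] assms(4) by simp
  then show ?thesis using card_sub_pos[OF assms(1)] by (simp add: Int_commute)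
qed

text \<open>Each \<open>c\<close> in \<open>W - H\<close> lies in exactly one such \<open>X\<close>,
  namely \<open>L + line c\<close>, and each \<open>X\<close> arises from the
  \<open>(q - 1) * card L\<close> vectors of \<open>X - L\<close>. Comparing with the
  \<open>(q - 1) * card H\<close> vectors of \<open>W - H\<close> gives the count.\<close>

lemma card_extensions_over_hyperplane:
  assumes "sub H" "sub W" "H \<subset> W" "card W = q * card H" "sub L" "L \<subseteq> H"
  shows "card {X. sub X \<and> X \<subseteq> W \<and> \<not> X \<subseteq> H \<and> X \<inter> H = L} * card L = card H"
    (is "card ?S * _ = _")
proof -
  have cV: "c \<in> carrier V" if "c \<in> W - H" for c using that assms sub_carrier by blast
  \<comment> \<open>Any vector of \<open>X\<close> outside \<open>H\<close> generates
    \<open>X\<close> over \<open>L\<close>: the inclusion is an equality because both sides have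
    \<open>q * card L\<close> elements.\<close>
  have eq: "L <+>\<^bsub>V\<^esub> line c = X" if X: "X \<in> ?S" and c: "c \<in> X" "c \<notin> H" for X c
  proof (rule card_seteq)
    have cV: "c \<in> carrier V" using X c sub_carrier by blast
    have sX: "sub X" using X by simp
    show "finite X" using finite_sub[OF sX] .
    show "L <+>\<^bsub>V\<^esub> line c \<subseteq> X"
      by (rule set_add_subset[OF sX _ line_subset[OF sX c(1)]]) (use X in auto)
    have "card X = q * card L"
      using card_eq_if_not_in_hyperplane[OF assms(1,2) _ assms(4) sX] X assms(3) by auto
    moreover have "c \<notin> L" using c assms by auto
    ultimately show "card X \<le> card (L <+>\<^bsub>V\<^esub> line c)"
      using card_add_line[OF assms(5) cV] by simp
  qed
  have mem: "L <+>\<^bsub>V\<^esub> line c \<in> ?S" "c \<in> L <+>\<^bsub>V\<^esub> line c" if c: "c \<in> W - H" for c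
  proof -
    note sl = sub_line[OF cV[OF c]]
    show cm: "c \<in> L <+>\<^bsub>V\<^esub> line c"
      using subset_set_add(2)[OF assms(5) sl] self_in_line[OF cV[OF c]] by blast
    have "L <+>\<^bsub>V\<^esub> line c \<subseteq> W"
      by (rule set_add_subset[OF assms(2) _ line_subset[OF assms(2)]]) (use assms c in auto)
    then show "L <+>\<^bsub>V\<^esub> line c \<in> ?S"
      using cm c sub_set_add[OF assms(5) sl] set_add_line_inter[OF assms(1,6) cV[OF c] _ assms(5)]
      by auto
  qed
  have "card (W - H) = card ?S * (card L * (q - 1))"
  proof (rule card_eq_card_times_fiber[where g = "\<lambda>c. L <+>\<^bsub>V\<^esub> line c"])
    show "finite (W - H)" using finite_sub assms by auto
    show "finite ?S" using finite_subs by auto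
    show "(\<lambda>c. L <+>\<^bsub>V\<^esub> line c) ` (W - H) \<subseteq> ?S" using mem by blast
    fix X assume X: "X \<in> ?S"
    \<comment> \<open>Within \<open>X\<close>, lying outside \<open>L\<close> is the same as lying
      outside \<open>H\<close>, because \<open>X \<inter> H = L\<close>.\<close>
    have "{c \<in> W - H. L <+>\<^bsub>V\<^esub> line c = X} = X - L"
    proof
      show "X - L \<subseteq> {c \<in> W - H. L <+>\<^bsub>V\<^esub> line c = X}" using eq[OF X] X by auto
      show "{c \<in> W - H. L <+>\<^bsub>V\<^esub> line c = X} \<subseteq> X - L" using mem(2) assms(6) by blast
    qed
    moreover have "card X = q * card L"
      using card_eq_if_not_in_hyperplane[OF assms(1,2) _ assms(4), of X] X assms(3) by auto
    moreover have "card (X - L) = card X - card L"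
      using X finite_sub[OF assms(5)] by (intro card_Diff_subset) auto
    ultimately show "card {c \<in> W - H. L <+>\<^bsub>V\<^esub> line c = X} = card L * (q - 1)"
      by (simp add: algebra_simps diff_mult_distrib)
  qed
  moreover have "card (W - H) = card H * (q - 1)"
    using assms finite_sub[OF assms(1)] by (simp add: card_Diff_subset diff_mult_distrib2 mult.commute)
  ultimately have "card H * (q - 1) = card ?S * card L * (q - 1)" by (simp add: mult.assoc)
  then show ?thesis using q_gt_1 by auto
qed

lemma sub_eq_if_card_le: "sub X \<Longrightarrow> sub Y \<Longrightarrow> X \<subseteq> Y \<Longrightarrow> card Y \<le> card X \<Longrightarrow> X = Y"
  using finite_sub card_seteq by metis

text \<open>The induction step shared by the two counts below: lowering the relative dimension of
  \<open>W\<close> over \<open>U\<close> by one while staying above \<open>U\<close>.\<close>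

lemma exists_hyperplane_power:
  assumes "sub U" "sub W" "U \<subseteq> W" "card W = card U * q ^ Suc a"
  obtains H where "sub H" "U \<subseteq> H" "H \<subset> W" "card W = q * card H" "card H = card U * q ^ a"
proof -
  have "1 < q ^ Suc a" using q_gt_1 by (intro one_less_power) auto
  then have "card U * 1 < card U * q ^ Suc a"
    using card_sub_pos[OF assms(1)] by (intro mult_strict_left_mono) auto
  then have "U \<subset> W" using assms(3,4) by auto
  then obtain H where H: "sub H" "U \<subseteq> H" "H \<subset> W" "card W = q * card H"
    using exists_hyperplane[OF assms(1,2)] by blast
  moreover have "card H = card U * q ^ a" using H(4) assms(4) q_gt_1 by simp
  ultimately show thesis by (rule that)
qed

lemma hyperplane_fiber:
  assumes "sub H" "sub W" "H \<subset> W" "card W = q * card H" "sub L" "L \<subseteq> H"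
    and "X \<in> {X. sub X \<and> X \<subseteq> W \<and> \<not> X \<subseteq> H \<and> X \<inter> H = L}"
  shows "card X = q * card L"
  using card_eq_if_not_in_hyperplane[OF assms(1,2) _ assms(4), of X] assms by auto

section \<open>Subspaces between two given ones\<close>

text \<open>Sizes are taken relative to \<open>U\<close>, so one induction covers both the subspaces
  of a space (\<open>U\<close> zero) and those of a quotient by \<open>U\<close>. For a hyperplane
  \<open>H\<close> above \<open>U\<close>, the subspaces inside \<open>H\<close> give the first term
  of the recursion for \<open>q_binomial\<close>, the remaining ones the second.\<close>

lemma card_intermediate_subspaces:
  assumes "sub U" "sub W" "U \<subseteq> W" "card W = card U * q ^ a"
  shows "card {X. sub X \<and> U \<subseteq> X \<and> X \<subseteq> W \<and> card X = card U * q ^ b} = q_binomial q a b"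
  using assms(2-)
proof (induction a arbitrary: W b)
  case (0 W)
  then have W: "W = U" using sub_eq_if_card_le[OF assms(1) 0(1,2)] by simp
  show ?case
  proof (cases b)
    case 0
    then have "{X. sub X \<and> U \<subseteq> X \<and> X \<subseteq> W \<and> card X = card U * q ^ b} = {U}"
      using W assms(1) by auto
    then show ?thesis using 0 by simp
  next
    case (Suc b')
    have "1 < q ^ b" unfolding Suc using q_gt_1 by (intro one_less_power) auto
    then have "{X. sub X \<and> U \<subseteq> X \<and> X \<subseteq> W \<and> card X = card U * q ^ b} = {}"
      using W card_sub_pos[OF assms(1)] by auto
    then have "card {X. sub X \<and> U \<subseteq> X \<and> X \<subseteq> W \<and> card X = card U * q ^ b} = 0"
      by (simp only: card.empty)
    then show ?thesis using Suc by simp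
  qed
next
  case (Suc a W)
  obtain H where H: "sub H" "U \<subseteq> H" "H \<subset> W" "card W = q * card H" and cH: "card H = card U * q ^ a"
    using exists_hyperplane_power[OF assms(1) Suc.prems] .
  show ?case
  proof (cases b)
    case 0
    have "X = U" if "sub X" "U \<subseteq> X" "card X = card U" for X
      using sub_eq_if_card_le[OF assms(1) that(1,2)] that(3) by simp
    then have "{X. sub X \<and> U \<subseteq> X \<and> X \<subseteq> W \<and> card X = card U * q ^ b} = {U}"
      using 0 assms(1) Suc.prems(2) by auto
    then show ?thesis using 0 by simp
  next
    case (Suc b')
    let ?in = "{X. sub X \<and> U \<subseteq> X \<and> X \<subseteq> H \<and> card X = card U * q ^ b}"
    let ?out = "{X. sub X \<and> U \<subseteq> X \<and> X \<subseteq> W \<and> \<not> X \<subseteq> H \<and> card X = card U * q ^ b}"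
    let ?R = "{L. sub L \<and> U \<subseteq> L \<and> L \<subseteq> H \<and> card L = card U * q ^ b'}"
    \<comment> \<open>A subspace not contained in \<open>H\<close> loses exactly one dimension when
      cut with \<open>H\<close>, so these are sorted by \<open>L = X \<inter> H\<close>; over each
      \<open>L\<close> there are \<open>card H / card L\<close> of them.\<close>
    have "card ?out = card ?R * q ^ (a - b')"
    proof (rule card_eq_card_times_fiber[where g = "\<lambda>X. X \<inter> H"])
      show "finite ?out" "finite ?R" using finite_subs by auto
      show "(\<lambda>X. X \<inter> H) ` ?out \<subseteq> ?R"
      proof (rule image_subsetI)
        fix X assume X: "X \<in> ?out"
        have "card X = q * card (X \<inter> H)"
          using card_eq_if_not_in_hyperplane[OF H(1) Suc.prems(1) _ H(4), of X] H(3) X by auto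
        then have "card (X \<inter> H) = card U * q ^ b'" using X Suc q_gt_1 by auto
        then show "X \<inter> H \<in> ?R" using X H(1,2) sub_inter by auto
      qed
      fix L assume L: "L \<in> ?R"
      let ?F = "{X. sub X \<and> X \<subseteq> W \<and> \<not> X \<subseteq> H \<and> X \<inter> H = L}"
      have "{X \<in> ?out. X \<inter> H = L} = ?F"
      proof
        show "?F \<subseteq> {X \<in> ?out. X \<inter> H = L}"
        proof
          fix X assume X: "X \<in> ?F"
          have "card X = card U * q ^ b"
            using hyperplane_fiber[OF H(1) Suc.prems(1) H(3,4) _ _ X] L Suc by simp
          then show "X \<in> {X \<in> ?out. X \<inter> H = L}" using X L by auto
        qed
      qed auto
      moreover have "card ?F * card L = card H"
        using card_extensions_over_hyperplane[OF H(1) Suc.prems(1) H(3,4)] L by blast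
      then have "card ?F * q ^ b' = q ^ a"
        using L cH card_sub_pos[OF assms(1)] by (simp add: mult.left_commute)
      \<comment> \<open>This makes \<open>a - b'\<close> a genuine difference. It follows from the
        presence of \<open>L\<close> inside \<open>H\<close>, so it is available exactly where a
        fibre has to be counted.\<close>
      moreover have "b' \<le> a"
      proof -
        have "card L \<le> card H" using L finite_sub[OF H(1)] by (intro card_mono) auto
        then have "q ^ b' \<le> q ^ a" using L cH card_sub_pos[OF assms(1)] by simp
        then show ?thesis using q_gt_1 by simp
      qed
      then have "q ^ a = q ^ (a - b') * q ^ b'" by (simp flip: power_add)
      ultimately show "card {X \<in> ?out. X \<inter> H = L} = q ^ (a - b')" using q_gt_1 by simp
    qed
    moreover have "card ?R = q_binomial q a b'" "card ?in = q_binomial q a b"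
      using Suc.IH[OF H(1,2) cH] by auto
    moreover have "{X. sub X \<and> U \<subseteq> X \<and> X \<subseteq> W \<and> card X = card U * q ^ b} = ?in \<union> ?out"
      using H(3) by auto
    moreover have "card (?in \<union> ?out) = card ?in + card ?out"
      using finite_subs by (intro card_Un_disjoint) auto
    ultimately show ?thesis using Suc by simp
  qed
qed

lemma card_subs_of_card:
  assumes "sub W" "card W = q ^ a"
  shows "card {X. sub X \<and> X \<subseteq> W \<and> card X = q ^ b} = q_binomial q a b"
proof -
  have "{X. sub X \<and> X \<subseteq> W \<and> card X = q ^ b}
      = {X. sub X \<and> {\<zero>\<^bsub>V\<^esub>} \<subseteq> X \<and> X \<subseteq> W \<and> card X = card {\<zero>\<^bsub>V\<^esub>} * q ^ b}"
    using sub_zero by auto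
  then show ?thesis
    using card_intermediate_subspaces[OF sub_zero_space assms(1), of a b] sub_zero[OF assms(1)] assms(2)
    by simp
qed

section \<open>Relative complements\<close>

text \<open>Modulo \<open>L\<close> these \<open>X\<close> are the complements of \<open>U/L\<close>
  in \<open>W/L\<close>, and there are \<open>(card U / card L) ^ m\<close> of them; the product
  form avoids the division. Cutting with a hyperplane \<open>H\<close> above \<open>U\<close> maps
  them to the complements inside \<open>H\<close>, with fibres of size
  \<open>card H / card Y = card U / card L\<close>.\<close>

lemma card_relative_complements:
  assumes "sub U" "sub L" "L \<subseteq> U" "sub W" "U \<subseteq> W" "card W = card U * q ^ m"
  shows "card {X. sub X \<and> X \<subseteq> W \<and> U \<inter> X = L \<and> card X = card L * q ^ m} * card L ^ m = card U ^ m"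
  using assms(4-)
proof (induction m arbitrary: W)
  case (0 W)
  have "X = L" if "sub X" "U \<inter> X = L" "card X = card L" for X
    using sub_eq_if_card_le[OF assms(2) that(1)] that by auto
  then have "{X. sub X \<and> X \<subseteq> W \<and> U \<inter> X = L \<and> card X = card L * q ^ 0} = {L}"
    using assms(2,3) 0 by auto
  then show ?case by simp
next
  case (Suc m W)
  let ?S = "\<lambda>W m. {X. sub X \<and> X \<subseteq> W \<and> U \<inter> X = L \<and> card X = card L * q ^ m}"
  obtain H where H: "sub H" "U \<subseteq> H" "H \<subset> W" "card W = q * card H" and cH: "card H = card U * q ^ m"
    using exists_hyperplane_power[OF assms(1) Suc.prems] .
  have pos: "card L > 0" "card U > 0" using card_sub_pos assms by auto
  \<comment> \<open>Division of natural numbers; that it is exact is shown only at the end, from a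
    nonempty set of complements in \<open>H\<close>.\<close>
  define k where "k = card U div card L"
  have fib: "card {X. sub X \<and> X \<subseteq> W \<and> \<not> X \<subseteq> H \<and> X \<inter> H = Y} * card L = card U"
    if Y: "Y \<in> ?S H m" for Y
  proof -
    have "card {X. sub X \<and> X \<subseteq> W \<and> \<not> X \<subseteq> H \<and> X \<inter> H = Y} * card Y = card H"
      using card_extensions_over_hyperplane[OF H(1) Suc.prems(1) H(3,4)] Y by blast
    then show ?thesis using Y cH q_gt_1 by simp
  qed
  have "card (?S W (Suc m)) = card (?S H m) * k"
  proof (rule card_eq_card_times_fiber[where g = "\<lambda>X. X \<inter> H"])
    show "finite (?S W (Suc m))" "finite (?S H m)" using finite_subs by auto
    \<comment> \<open>Inside \<open>H\<close> there is no room: by the dimension formula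
      \<open>U + X\<close> has \<open>card U * q ^ Suc m\<close> elements, more than
      \<open>H\<close> has.\<close>
    have nsub: "\<not> X \<subseteq> H" if X: "X \<in> ?S W (Suc m)" for X
    proof
      assume "X \<subseteq> H"
      have sX: "sub X" using X by simp
      have "card (U <+>\<^bsub>V\<^esub> X) \<le> card H"
        using finite_sub[OF H(1)] set_add_subset[OF H(1,2) \<open>X \<subseteq> H\<close>] by (rule card_mono)
      then have "card (U <+>\<^bsub>V\<^esub> X) * card L \<le> card H * card L" by (rule mult_le_mono1)
      moreover have "card U * card X = card (U <+>\<^bsub>V\<^esub> X) * card L"
        using card_set_add[OF assms(1) sX] X by simp
      ultimately have "card U * card X \<le> card H * card L" by simp
      then have "card U * card L * q ^ Suc m \<le> card U * card L * q ^ m"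
        using X cH by (simp add: mult_ac)
      then have "q ^ Suc m \<le> q ^ m" using pos by (simp del: power_Suc)
      then show False using power_le_imp_le_exp[OF q_gt_1, of "Suc m" m] by simp
    qed
    show "(\<lambda>X. X \<inter> H) ` ?S W (Suc m) \<subseteq> ?S H m"
    proof (rule image_subsetI)
      fix X assume X: "X \<in> ?S W (Suc m)"
      have "card X = q * card (X \<inter> H)"
        using card_eq_if_not_in_hyperplane[OF H(1) Suc.prems(1) _ H(4), of X] H(3) X nsub[OF X] by auto
      then have "card (X \<inter> H) = card L * q ^ m" using X q_gt_1 by auto
      then show "X \<inter> H \<in> ?S H m" using X H(1,2) sub_inter by auto
    qed
    fix Y assume Y: "Y \<in> ?S H m"
    have "{X \<in> ?S W (Suc m). X \<inter> H = Y} = {X. sub X \<and> X \<subseteq> W \<and> \<not> X \<subseteq> H \<and> X \<inter> H = Y}"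
      (is "_ = ?F")
    proof
      show "{X \<in> ?S W (Suc m). X \<inter> H = Y} \<subseteq> ?F" using nsub by auto
      show "?F \<subseteq> {X \<in> ?S W (Suc m). X \<inter> H = Y}"
      proof
        fix X assume X: "X \<in> ?F"
        have "card X = card L * q ^ Suc m"
          using hyperplane_fiber[OF H(1) Suc.prems(1) H(3,4) _ _ X] Y by simp
        moreover have "U \<inter> X = L" using X Y H(2) by auto
        ultimately show "X \<in> {X \<in> ?S W (Suc m). X \<inter> H = Y}" using X by auto
      qed
    qed
    then show "card {X \<in> ?S W (Suc m). X \<inter> H = Y} = k"
      unfolding k_def fib[OF Y, symmetric] using pos by simp
  qed
  moreover have IH: "card (?S H m) * card L ^ m = card U ^ m" by (rule Suc.IH[OF H(1,2) cH])
  moreover have "k * card L = card U"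
  proof -
    \<comment> \<open>The induction hypothesis has a positive right side, so some complement
      \<open>Y\<close> exists, and the count of its fibre exhibits \<open>card U\<close> as a
      multiple of \<open>card L\<close>.\<close>
    have "?S H m \<noteq> {}"
    proof
      assume "?S H m = {}"
      then have "card (?S H m) = 0" by (simp only: card.empty)
      then show False using IH pos by simp
    qed
    then obtain Y where Y: "Y \<in> ?S H m" unfolding ex_in_conv[symmetric] by (rule exE)
    have "card L dvd card U" unfolding fib[OF Y, symmetric] by simp
    then show ?thesis by (simp add: k_def)
  qed
  moreover have "card (?S H m) * k * card L ^ Suc m = card (?S H m) * card L ^ m * (k * card L)"
    by simp
  ultimately show ?case by (simp only: power_Suc mult.commute)
qed

section \<open>Quotients and avoiding joins\<close>

text \<open>The coset map from \<open>W\<close> onto \<open>W/U\<close> has fibres of size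
  \<open>card U\<close>, so \<open>card W = card (W/U) * card U\<close>, and the quotient is itself
  a finite vector space in which dimension is read off from size.\<close>

lemma mem_quotient_grassmannian:
  assumes "sub U" "sub W" "U \<subseteq> W"
  shows "quotient_subspace V W U \<in> grassmannian K (quotient_space V U) j \<longleftrightarrow> card W = card U * q ^ j"
proof -
  interpret Q: vectorspace K "quotient_space V U" using quotient_space_is_vectorspace[OF assms(1)] .
  have "subgroup U (add_monoid V)"
    by (rule M.add.subgroupI)
      (use sub_subset[OF assms(1)] sub_zero[OF assms(1)] sub_neg[OF assms(1)] sub_add[OF assms(1)]
        in \<open>auto simp: a_inv_def\<close>)
  then interpret S: additive_subgroup U V by (rule additive_subgroup.intro)
  interpret S: abelian_subgroup U V by (rule abelian_subgroupI3) (unfold_locales)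
  have carr: "carrier (quotient_space V U) = (\<lambda>x. U +>\<^bsub>V\<^esub> x) ` carrier V"
    by (auto simp: quotient_space_def A_RCOSETS_def')
  interpret Q: finite_vectorspace K "quotient_space V U"
    using finite_K finite_V by unfold_locales (auto simp: carr)
  let ?X = "quotient_subspace V W U"
  have coset_mem: "y \<in> U +>\<^bsub>V\<^esub> x \<longleftrightarrow> (\<exists>u\<in>U. y = u \<oplus>\<^bsub>V\<^esub> x)" for x y
    by (auto simp: a_r_coset_def')
  have coset_self: "x \<in> U +>\<^bsub>V\<^esub> x" if "x \<in> carrier V" for x
    using S.a_rcos_self[OF that] .
  have coset_eq: "U +>\<^bsub>V\<^esub> y = U +>\<^bsub>V\<^esub> x \<longleftrightarrow> y \<in> U +>\<^bsub>V\<^esub> x"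
    if "x \<in> carrier V" "y \<in> carrier V" for x y
    using that coset_self M.a_repr_independence[OF _ that(1) S.a_subgroup] by metis
  have "Q.sub ?X"
  proof (rule Q.subI)
    show "?X \<subseteq> carrier (quotient_space V U)"
      using sub_subset[OF assms(2)] by (auto simp: carr quotient_subspace_def)
    show "\<zero>\<^bsub>quotient_space V U\<^esub> \<in> ?X"
      using sub_zero[OF assms(2)] sub_subset[OF assms(1)]
      by (auto simp: quotient_space_def quotient_subspace_def image_iff intro!: bexI[of _ "\<zero>\<^bsub>V\<^esub>"])
  next
    fix A B assume "A \<in> ?X" "B \<in> ?X"
    then obtain x y where xy: "x \<in> W" "A = U +>\<^bsub>V\<^esub> x" "y \<in> W" "B = U +>\<^bsub>V\<^esub> y"
      by (auto simp: quotient_subspace_def)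
    then have "A \<oplus>\<^bsub>quotient_space V U\<^esub> B = U +>\<^bsub>V\<^esub> (x \<oplus>\<^bsub>V\<^esub> y)"
      using sub_carrier[OF assms(2)] by (simp add: quotient_space_def S.a_rcos_sum)
    then show "A \<oplus>\<^bsub>quotient_space V U\<^esub> B \<in> ?X"
      using xy sub_add[OF assms(2)] by (auto simp: quotient_subspace_def)
  next
    fix c A assume c: "c \<in> carrier K" and "A \<in> ?X"
    then obtain x where x: "x \<in> W" "A = U +>\<^bsub>V\<^esub> x" by (auto simp: quotient_subspace_def)
    have xV: "x \<in> carrier V" using x sub_carrier[OF assms(2)] by simp
    \<comment> \<open>Scalar multiples in the quotient are not recomputed: the multiple of
      \<open>A\<close> is some coset by closure, and it contains the multiple of \<open>x\<close>,
      which identifies it.\<close>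
    have "A \<in> carrier (quotient_space V U)" using x xV by (auto simp: carr)
    then have "c \<odot>\<^bsub>quotient_space V U\<^esub> A \<in> carrier (quotient_space V U)" using c by simp
    then obtain y where y: "y \<in> carrier V" "c \<odot>\<^bsub>quotient_space V U\<^esub> A = U +>\<^bsub>V\<^esub> y"
      by (auto simp: carr)
    have "c \<odot>\<^bsub>V\<^esub> x \<in> U <+>\<^bsub>V\<^esub> ((\<lambda>x. c \<odot>\<^bsub>V\<^esub> x) ` A)"
      using set_addI[OF sub_zero[OF assms(1)], of "c \<odot>\<^bsub>V\<^esub> x" "(\<lambda>x. c \<odot>\<^bsub>V\<^esub> x) ` A"]
        coset_self[OF xV] x c xV by simp
    then have "c \<odot>\<^bsub>V\<^esub> x \<in> U +>\<^bsub>V\<^esub> y" using y by (simp add: quotient_space_def)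
    then have "U +>\<^bsub>V\<^esub> y = U +>\<^bsub>V\<^esub> (c \<odot>\<^bsub>V\<^esub> x)"
      using coset_eq[OF y(1), of "c \<odot>\<^bsub>V\<^esub> x"] c xV by auto
    then show "c \<odot>\<^bsub>quotient_space V U\<^esub> A \<in> ?X"
      using y x c sub_smult[OF assms(2)] by (auto simp: quotient_subspace_def)
  qed
  moreover have "card W = card ?X * card U"
  proof (rule card_eq_card_times_fiber[where g = "\<lambda>x. U +>\<^bsub>V\<^esub> x"])
    show "finite W" "finite ?X"
      using finite_sub[OF assms(2)] by (auto simp: quotient_subspace_def)
    show "(\<lambda>x. U +>\<^bsub>V\<^esub> x) ` W \<subseteq> ?X" by (simp add: quotient_subspace_def)
    fix A assume "A \<in> ?X"
    then obtain x where x: "x \<in> W" "A = U +>\<^bsub>V\<^esub> x" by (auto simp: quotient_subspace_def)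
    have xV: "x \<in> carrier V" using x sub_carrier[OF assms(2)] by simp
    have "{y \<in> W. U +>\<^bsub>V\<^esub> y = A} = A"
    proof
      show "{y \<in> W. U +>\<^bsub>V\<^esub> y = A} \<subseteq> A" using coset_self sub_carrier[OF assms(2)] by auto
      show "A \<subseteq> {y \<in> W. U +>\<^bsub>V\<^esub> y = A}"
      proof
        fix y assume y: "y \<in> A"
        then have "y \<in> W" using x assms(3) sub_add[OF assms(2)] by (auto simp: coset_mem)
        then show "y \<in> {y \<in> W. U +>\<^bsub>V\<^esub> y = A}"
          using coset_eq[OF xV] sub_carrier[OF assms(2)] y x by auto
      qed
    qed
    moreover have "card A = card U"
      using M.a_card_cosets_equal[OF _ sub_subset[OF assms(1)] finite_V] x(2) xV
        M.a_rcosetsI[OF sub_subset[OF assms(1)] xV] by simp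
    ultimately show "card {y \<in> W. U +>\<^bsub>V\<^esub> y = A} = card U" by simp
  qed
  ultimately show ?thesis using card_sub_pos[OF assms(1)] by (simp add: Q.grassmannian_eq mult.commute)
qed

text \<open>Avoidance moves the condition on the intersection from \<open>U\<^sub>1\<close> to
  \<open>U\<^sub>2\<close>, and the dimension formula turns \<open>U\<^sub>2 + X = W\<close> into a
  condition on \<open>card X\<close>. What remains is the set counted in
  \<open>card_relative_complements\<close>.\<close>

lemma avoiding_join_eq:
  assumes "sub U\<^sub>1" "sub U\<^sub>2" "U\<^sub>1 \<subseteq> U\<^sub>2" "sub L" "L \<subseteq> U\<^sub>1" "sub W" "U\<^sub>2 \<subseteq> W"
    and "card W = card U\<^sub>2 * q ^ m"
  shows "avoiding_join K V U\<^sub>1 U\<^sub>2 L W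
    = {X. sub X \<and> X \<subseteq> W \<and> U\<^sub>2 \<inter> X = L \<and> card X = card L * q ^ m}"
proof (rule Set.set_eqI)
  fix X
  show "X \<in> avoiding_join K V U\<^sub>1 U\<^sub>2 L W
    \<longleftrightarrow> X \<in> {X. sub X \<and> X \<subseteq> W \<and> U\<^sub>2 \<inter> X = L \<and> card X = card L * q ^ m}"
  proof (cases "sub X \<and> X \<subseteq> W \<and> U\<^sub>2 \<inter> X = L")
    case True
    then have sX: "sub X" by simp
    have "U\<^sub>2 <+>\<^bsub>V\<^esub> X \<subseteq> W" using set_add_subset[OF assms(6,7)] True by simp
    then have "U\<^sub>2 <+>\<^bsub>V\<^esub> X = W \<longleftrightarrow> card (U\<^sub>2 <+>\<^bsub>V\<^esub> X) = card W"
      using card_subset_eq[OF finite_sub[OF assms(6)]] by blast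
    also have "\<dots> \<longleftrightarrow> card (U\<^sub>2 <+>\<^bsub>V\<^esub> X) * card L = card W * card L"
      using card_sub_pos[OF assms(4)] by simp
    also have "\<dots> \<longleftrightarrow> card U\<^sub>2 * card X = card U\<^sub>2 * (card L * q ^ m)"
      using card_set_add[OF assms(2) sX] True assms(8) by (simp add: mult_ac)
    also have "\<dots> \<longleftrightarrow> card X = card L * q ^ m" using card_sub_pos[OF assms(2)] by simp
    finally have "U\<^sub>2 <+>\<^bsub>V\<^esub> X = W \<longleftrightarrow> card X = card L * q ^ m" .
    moreover have "U\<^sub>1 \<inter> X = L" using True assms(3,5) by auto
    ultimately show ?thesis using True by (simp add: avoiding_join_def avoids_factor_def)
  next
    case False
    then show ?thesis
      using subset_set_add(2)[OF assms(2), of X] by (auto simp: avoiding_join_def avoids_factor_def)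
  qed
qed

text \<open>The only pair that can witness membership of \<open>X\<close> is its intersection with
  \<open>U\<^sub>1\<close> and its sum with \<open>U\<^sub>2\<close>. Avoidance amounts to equal
  sizes of two nested intersections, so only dimensions remain.\<close>

lemma mem_avoiding_join_sets_grassmannian:
  assumes "sub U\<^sub>1" "sub U\<^sub>2" "U\<^sub>1 \<subseteq> U\<^sub>2"
  shows "X \<in> avoiding_join_sets K V U\<^sub>1 U\<^sub>2
      (grassmannian K (V\<lparr>carrier := U\<^sub>1\<rparr>) i) (grassmannian K (quotient_space V U\<^sub>2) j)
    \<longleftrightarrow> sub X \<and> card (U\<^sub>1 \<inter> X) = q ^ i \<and> card (U\<^sub>2 \<inter> X) = q ^ i \<and> card X = q ^ (i + j)"
  (is "?l \<longleftrightarrow> ?r")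
proof
  assume ?l
  then obtain W where W: "sub W" "U\<^sub>2 \<subseteq> W"
      "quotient_subspace V W U\<^sub>2 \<in> grassmannian K (quotient_space V U\<^sub>2) j"
    and X: "U\<^sub>1 \<inter> X \<in> grassmannian K (V\<lparr>carrier := U\<^sub>1\<rparr>) i" "sub X" "U\<^sub>2 <+>\<^bsub>V\<^esub> X = W"
      "U\<^sub>1 \<inter> X = U\<^sub>2 \<inter> X"
    by (auto simp: avoiding_join_sets_def avoiding_join_def avoids_factor_def)
  have cW: "card W = card U\<^sub>2 * q ^ j" using mem_quotient_grassmannian[OF assms(2) W(1,2)] W(3) by simp
  have c: "card (U\<^sub>1 \<inter> X) = q ^ i" using X(1) by (simp add: grassmannian_restrict[OF assms(1)])
  then have "card U\<^sub>2 * card X = card U\<^sub>2 * q ^ (i + j)"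
    using card_set_add[OF assms(2) X(2)] X(3,4) cW by (simp add: power_add mult_ac)
  then show ?r using X c card_sub_pos[OF assms(2)] by simp
next
  assume r: ?r
  then have sX: "sub X" by simp
  have eq: "U\<^sub>1 \<inter> X = U\<^sub>2 \<inter> X"
    by (rule sub_eq_if_card_le) (use r assms sub_inter in auto)
  let ?W = "U\<^sub>2 <+>\<^bsub>V\<^esub> X"
  note W = sub_set_add[OF assms(2) sX] subset_set_add(1)[OF assms(2) sX]
  have "card ?W * q ^ i = card U\<^sub>2 * q ^ j * q ^ i"
    using card_set_add[OF assms(2) sX, symmetric] r by (simp add: power_add mult_ac)
  then have "card ?W = card U\<^sub>2 * q ^ j" using q_gt_1 by simp
  then have "quotient_subspace V ?W U\<^sub>2 \<in> grassmannian K (quotient_space V U\<^sub>2) j"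
    using mem_quotient_grassmannian[OF assms(2) W] by simp
  moreover have "U\<^sub>1 \<inter> X \<in> grassmannian K (V\<lparr>carrier := U\<^sub>1\<rparr>) i"
    using r sub_inter[OF assms(1) sX] by (simp add: grassmannian_restrict[OF assms(1)])
  moreover have "X \<in> avoiding_join K V U\<^sub>1 U\<^sub>2 (U\<^sub>1 \<inter> X) ?W"
    using sX eq by (simp add: avoiding_join_def avoids_factor_def)
  ultimately show ?l using W unfolding avoiding_join_sets_def by blast
qed

text \<open>Sending \<open>X\<close> to its intersection with \<open>U\<^sub>1\<close> and its sum
  with \<open>U\<^sub>2\<close> has the single avoiding joins as fibres. Each has
  \<open>(card U\<^sub>2 / card L) ^ j = q ^ (t * j)\<close> elements, where \<open>t\<close> is the
  dimension of \<open>U\<^sub>2\<close> modulo an \<open>i\<close>-dimensional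
  \<open>L\<close>.\<close>

lemma card_avoiding_join_sets_grassmannian:
  assumes "sub U\<^sub>1" "sub U\<^sub>2" "U\<^sub>1 \<subseteq> U\<^sub>2" "card U\<^sub>1 = q ^ n" "card U\<^sub>2 = q ^ (t + i)"
    and "card (carrier V) = card U\<^sub>2 * q ^ r"
  shows "card (avoiding_join_sets K V U\<^sub>1 U\<^sub>2
      (grassmannian K (V\<lparr>carrier := U\<^sub>1\<rparr>) i) (grassmannian K (quotient_space V U\<^sub>2) j))
    = q ^ (t * j) * q_binomial q n i * q_binomial q r j"
proof -
  let ?S = "avoiding_join_sets K V U\<^sub>1 U\<^sub>2
      (grassmannian K (V\<lparr>carrier := U\<^sub>1\<rparr>) i) (grassmannian K (quotient_space V U\<^sub>2) j)"
  let ?A = "{L. sub L \<and> L \<subseteq> U\<^sub>1 \<and> card L = q ^ i}"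
  let ?B = "{W. sub W \<and> U\<^sub>2 \<subseteq> W \<and> W \<subseteq> carrier V \<and> card W = card U\<^sub>2 * q ^ j}"
  have B: "{W. sub W \<and> U\<^sub>2 \<subseteq> W \<and> quotient_subspace V W U\<^sub>2 \<in> grassmannian K (quotient_space V U\<^sub>2) j}
      = ?B"
    using mem_quotient_grassmannian[OF assms(2)] sub_subset by auto
  have S: "?S = (\<Union>L\<in>?A. \<Union>W\<in>?B. avoiding_join K V U\<^sub>1 U\<^sub>2 L W)"
    unfolding avoiding_join_sets_def grassmannian_restrict[OF assms(1)] B ..
  have "card ?S = card (?A \<times> ?B) * q ^ (t * j)"
  proof (rule card_eq_card_times_fiber[where g = "\<lambda>X. (U\<^sub>1 \<inter> X, U\<^sub>2 <+>\<^bsub>V\<^esub> X)"])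
    show "finite ?S"
      by (rule finite_subset[OF _ finite_subs[of "\<lambda>_. True"]]) (auto simp: S avoiding_join_def)
    show "finite (?A \<times> ?B)" using finite_subs by simp
    show "(\<lambda>X. (U\<^sub>1 \<inter> X, U\<^sub>2 <+>\<^bsub>V\<^esub> X)) ` ?S \<subseteq> ?A \<times> ?B"
      unfolding S by (auto simp: avoiding_join_def)
    fix p assume "p \<in> ?A \<times> ?B"
    then obtain L W where p: "p = (L, W)" and L: "sub L" "L \<subseteq> U\<^sub>1" "card L = q ^ i"
      and W: "sub W" "U\<^sub>2 \<subseteq> W" "card W = card U\<^sub>2 * q ^ j" by auto
    let ?J = "avoiding_join K V U\<^sub>1 U\<^sub>2 L W"
    have "{X \<in> ?S. (U\<^sub>1 \<inter> X, U\<^sub>2 <+>\<^bsub>V\<^esub> X) = p} = ?J"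
      unfolding S using \<open>p \<in> ?A \<times> ?B\<close> by (auto simp: p avoiding_join_def)
    moreover have "card ?J * card L ^ j = card U\<^sub>2 ^ j"
      unfolding avoiding_join_eq[OF assms(1-3) L(1,2) W]
      by (rule card_relative_complements) (use L W assms in auto)
    then have "card ?J * q ^ (i * j) = q ^ (t * j) * q ^ (i * j)"
      using L(3) assms(5) by (simp add: power_mult power_add power_mult_distrib)
    then have "card ?J = q ^ (t * j)" using q_gt_1 by simp
    ultimately show "card {X \<in> ?S. (U\<^sub>1 \<inter> X, U\<^sub>2 <+>\<^bsub>V\<^esub> X) = p} = q ^ (t * j)" by simp
  qed
  moreover have "card ?A = q_binomial q n i" by (rule card_subs_of_card[OF assms(1,4)])
  moreover have "card ?B = q_binomial q r j"
    by (rule card_intermediate_subspaces[OF assms(2) sub_self sub_subset[OF assms(2)] assms(6)])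
  ultimately show ?thesis by (simp add: card_cartesian_product)
qed

text \<open>The coordinate space has \<open>q ^ a\<close> vectors, so the general count of subspaces
  applies to it and shows that the choice of space is immaterial.\<close>

lemma gaussian_binomial_eq: "gaussian_binomial K a b = q_binomial q a b"
proof -
  interpret F: vectorspace K "func_space {..<a}" by (rule func_space_is_vs)
  have carr: "carrier (func_space {..<a}) = {..<a} \<rightarrow>\<^sub>E carrier K" by (simp add: func_space_def)
  interpret F: finite_vectorspace K "func_space {..<a}"
    using finite_K by unfold_locales (auto simp: carr intro: finite_PiE)
  have "card (carrier (func_space {..<a})) = q ^ a" by (simp add: carr card_PiE)
  from F.card_subs_of_card[OF F.sub_self this, of b] show ?thesis
    unfolding gaussian_binomial_def F.grassmannian_eq using F.sub_subset by (metis (no_types, lifting) Collect_cong)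
qed

section \<open>Dimensions along the chain\<close>

text \<open>The exponents increase strictly at each of \<open>v\<close> steps and end at
  \<open>v\<close>, which leaves no slack: each equals its index.\<close>

lemma card_chain:
  assumes "\<And>i. i \<le> v \<Longrightarrow> sub (U i)" "\<And>i. i < v \<Longrightarrow> U i \<subset> U (Suc i)"
    and "U v = carrier V" "card (carrier V) = q ^ v" "i \<le> v"
  shows "card (U i) = q ^ i"
proof -
  define d where "d = (\<lambda>i. SOME d. card (U i) = q ^ d)"
  have d: "card (U i) = q ^ d i" if "i \<le> v" for i
    unfolding d_def using card_sub_eq_power[OF assms(1)[OF that]] by (rule someI_ex)
  have "d i < d (Suc i)" if "i < v" for i
  proof -
    have "card (U i) < card (U (Suc i))"
      using psubset_card_mono[OF finite_sub[OF assms(1)] assms(2)[OF that]] that by simp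
    then show ?thesis using d[of i] d[of "Suc i"] that q_gt_1 by simp
  qed
  note inc = le_of_strict_increasing[of v d, OF this]
  have "d v = v" using d[of v] assms(3,4) q_gt_1 by simp
  then have "d i = i" using inc[of 0 i] inc[of i v] assms(5) by simp
  then show ?thesis using d assms(5) by simp
qed

text \<open>Either \<open>W \<inter> X\<close> lies in \<open>H\<close>, and the two intersections
  agree, or cutting it with \<open>H\<close> costs exactly one dimension.\<close>

lemma dim_inter_step:
  assumes "sub H" "sub W" "H \<subseteq> W" "card W = q * card H" "sub X"
    and "card (H \<inter> X) = q ^ a" "card (W \<inter> X) = q ^ b"
  shows "a \<le> b" "b \<le> Suc a"
proof -
  have "card (H \<inter> X) \<le> card (W \<inter> X)"
    using finite_sub[OF assms(2)] assms(3) by (intro card_mono) auto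
  then show "a \<le> b" using assms q_gt_1 by simp
  have eq: "W \<inter> X \<inter> H = H \<inter> X" using assms(3) by auto
  show "b \<le> Suc a"
  proof (cases "W \<inter> X \<subseteq> H")
    case True
    then have "W \<inter> X = H \<inter> X" using assms(3) by auto
    then have "q ^ b = q ^ a" using assms(6,7) by simp
    then show ?thesis using q_gt_1 by simp
  next
    case False
    have "card (W \<inter> X) = q * card (W \<inter> X \<inter> H)"
      by (rule card_eq_if_not_in_hyperplane[OF assms(1-4) sub_inter[OF assms(2,5)] _ False]) auto
    then have "q ^ b = q ^ Suc a" unfolding eq assms(6,7) by simp
    then show ?thesis using q_gt_1 by (simp del: power_Suc)
  qed
qed

lemma diagonal_intersection:
  assumes U: "\<And>i. i \<le> v \<Longrightarrow> sub (U i)" "\<And>i. i < v \<Longrightarrow> U i \<subset> U (Suc i)"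
      "\<And>i. i \<le> v \<Longrightarrow> card (U i) = q ^ i"
    and X: "sub X" "card X = q ^ k" and sk: "s + k + 1 \<le> v"
  shows "\<exists>!i. i \<le> k \<and> card (U (s + i) \<inter> X) = q ^ i \<and> card (U (s + i + 1) \<inter> X) = q ^ i"
proof -
  define f where "f = (\<lambda>j. SOME d. card (U j \<inter> X) = q ^ d)"
  have f: "card (U j \<inter> X) = q ^ f j" if "j \<le> v" for j
    unfolding f_def using card_sub_eq_power[OF sub_inter[OF U(1)[OF that] X(1)]] by (rule someI_ex)
  have f_iff: "card (U j \<inter> X) = q ^ n \<longleftrightarrow> f j = n" if "j \<le> v" for j n
    using f[OF that] q_gt_1 by simp
  have step: "f j \<le> f (Suc j)" "f (Suc j) \<le> Suc (f j)" if "j < v" for j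
    using dim_inter_step[OF U(1) U(1) _ _ X(1) f f, of j "Suc j"] U(2)[OF that] U(3)[of j]
      U(3)[of "Suc j"] that by auto
  have le_k: "f j \<le> k" if "j \<le> v" for j
  proof -
    have "card (U j \<inter> X) \<le> card X" using finite_sub[OF X(1)] by (intro card_mono) auto
    then show ?thesis using f[OF that] X(2) q_gt_1 by simp
  qed
  \<comment> \<open>The index \<open>0\<close> always satisfies the condition and \<open>k\<close>
    bounds it, so a greatest such index exists.\<close>
  have "\<exists>i. (i \<le> k \<and> i \<le> f (s + i)) \<and> (\<forall>y. y \<le> k \<and> y \<le> f (s + y) \<longrightarrow> y \<le> i)"
    by (rule Nat.ex_has_greatest_nat[of _ 0 k]) auto
  then obtain i where i: "i \<le> k" "i \<le> f (s + i)"
    and max: "\<And>y. y \<le> k \<Longrightarrow> y \<le> f (s + y) \<Longrightarrow> y \<le> i" by blast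
  \<comment> \<open>A larger value would make \<open>i + 1\<close> satisfy the condition, against
    maximality, unless \<open>i = k\<close>; there the bound by \<open>dim X = k\<close>
    applies.\<close>
  have "f (s + i + 1) \<le> i"
  proof (cases "i = k")
    case True
    then show ?thesis using le_k[of "s + i + 1"] sk by simp
  next
    case False
    then show ?thesis using max[of "i + 1"] i(1) by fastforce
  qed
  \<comment> \<open>Monotonicity squeezes both values:
    \<open>i \<le> f (s + i) \<le> f (s + i + 1) \<le> i\<close>.\<close>
  then have "f (s + i) = i" "f (s + i + 1) = i" using step(1)[of "s + i"] i sk by auto
  moreover have "i' = i''"
    if "i' \<le> k" "f (s + i') = i'" "f (s + i' + 1) = i'" "i'' \<le> k" "f (s + i'') = i''" "f (s + i'' + 1) = i''"
    for i' i''
    using diagonal_unique[of s k f i' i''] diagonal_unique[of s k f i'' i'] step(2) sk that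
    by (metis linorder_neqE_nat less_le_trans)
  ultimately show ?thesis using i(1) sk by (intro ex1I[of _ i]) (auto simp: f_iff)
qed

end

section \<open>Decomposition of the Grassmannian and the resulting identity\<close>

theorem theorem3p19:
  fixes F :: "('a, 'r) ring_scheme"
    and V :: "('a, 'b, 'm) module_scheme"
    and U :: "nat \<Rightarrow> 'b set"
    and q v k s :: nat
  assumes "vectorspace F V"
    and "finite (carrier F)" and "card (carrier F) = q"
    and "vectorspace.fin_dim F V" and "vectorspace.dim F V = v"
    and "\<And>i. i \<le> v \<Longrightarrow> VectorSpace.subspace F (U i) V"
    and "U 0 = {\<zero>\<^bsub>V\<^esub>}" and "U v = carrier V"
    and "\<And>i. i < v \<Longrightarrow> U i \<subset> U (Suc i)"
    and "k \<le> v" and "s + k + 1 \<le> v"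
  shows "grassmannian F V k =
           (\<Union>i\<in>{0..k}.
              avoiding_join_sets F V (U (s + i)) (U (s + i + 1))
                (grassmannian F (V\<lparr>carrier := U (s + i)\<rparr>) i)
                (grassmannian F (quotient_space V (U (s + i + 1))) (k - i)))
         \<and> disjoint_family_on
             (\<lambda>i. avoiding_join_sets F V (U (s + i)) (U (s + i + 1))
                (grassmannian F (V\<lparr>carrier := U (s + i)\<rparr>) i)
                (grassmannian F (quotient_space V (U (s + i + 1))) (k - i)))
             {0..k}
         \<and> gaussian_binomial F v k =
             (\<Sum>i=0..k. q ^ ((s + 1) * (k - i)) * gaussian_binomial F (s + i) i
                          * gaussian_binomial F (v - s - i - 1) (k - i))"
proof -
  interpret vectorspace F V by fact
  interpret finite_vectorspace F V
    by unfold_locales (use assms finite_carrier_if_fin_dim in auto)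
  note [simp] = assms(3)
  let ?P = "\<lambda>i. avoiding_join_sets F V (U (s + i)) (U (s + i + 1))
      (grassmannian F (V\<lparr>carrier := U (s + i)\<rparr>) i)
      (grassmannian F (quotient_space V (U (s + i + 1))) (k - i))"
  have cV: "card (carrier V) = q ^ v" using card_carrier_dim(2) assms(5) by simp
  have cU: "card (U i) = q ^ i" if "i \<le> v" for i
    using card_chain[OF assms(6,9,8) _ that] cV by simp
  have sU: "sub (U (s + i))" "sub (U (s + i + 1))" "U (s + i) \<subseteq> U (s + i + 1)" if "i \<le> k" for i
    using assms(6)[of "s + i"] assms(6)[of "s + i + 1"] assms(9)[of "s + i"] assms(11) that by auto
  \<comment> \<open>Here \<open>i + (k - i) = k\<close>, so all pieces share the condition on
    \<open>card X\<close> and differ only in the diagonal condition. Existence of the diagonal index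
    in \<open>diag\<close> then gives the union, its uniqueness the disjointness.\<close>
  have mem: "X \<in> ?P i \<longleftrightarrow> sub X \<and> card X = q ^ k
      \<and> card (U (s + i) \<inter> X) = q ^ i \<and> card (U (s + i + 1) \<inter> X) = q ^ i" if "i \<le> k" for X i
    using mem_avoiding_join_sets_grassmannian[OF sU[OF that], of X i "k - i"] that by auto
  have diag: "\<exists>!i. i \<le> k \<and> card (U (s + i) \<inter> X) = q ^ i \<and> card (U (s + i + 1) \<inter> X) = q ^ i"
    if "sub X" "card X = q ^ k" for X
    using diagonal_intersection[of v U X k s, OF assms(6,9) _ that(1) _ assms(11)] cU that(2) by simp
  have union: "grassmannian F V k = (\<Union>i\<in>{0..k}. ?P i)"
  proof (rule Set.set_eqI)
    fix X
    have "X \<in> grassmannian F V k \<longleftrightarrow> sub X \<and> card X = q ^ k" by (simp add: grassmannian_eq)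
    also have "\<dots> \<longleftrightarrow> (\<exists>i\<le>k. X \<in> ?P i)"
    proof
      assume X: "sub X \<and> card X = q ^ k"
      then obtain i where "i \<le> k" "card (U (s + i) \<inter> X) = q ^ i" "card (U (s + i + 1) \<inter> X) = q ^ i"
        using ex1_implies_ex[OF diag[of X]] by (elim exE conjE) auto
      then show "\<exists>i\<le>k. X \<in> ?P i" using X mem[of i X] by auto
    next
      assume "\<exists>i\<le>k. X \<in> ?P i"
      then obtain i where "i \<le> k" "X \<in> ?P i" by (elim exE conjE)
      then show "sub X \<and> card X = q ^ k" using mem[of i X] by simp
    qed
    also have "\<dots> \<longleftrightarrow> X \<in> (\<Union>i\<in>{0..k}. ?P i)" by (simp add: Bex_def)
    finally show "X \<in> grassmannian F V k \<longleftrightarrow> X \<in> (\<Union>i\<in>{0..k}. ?P i)" .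
  qed
  have disj: "disjoint_family_on ?P {0..k}"
    unfolding disjoint_family_on_def
  proof (intro ballI impI equals0I)
    fix i j X assume ij: "i \<in> {0..k}" "j \<in> {0..k}" "i \<noteq> j" and "X \<in> ?P i \<inter> ?P j"
    then show False using mem[of i X] mem[of j X] diag[of X] by auto
  qed
  \<comment> \<open>The factor \<open>s + 1\<close> in the exponent arises from writing the
    dimension of \<open>U (s + i + 1)\<close> as \<open>(s + 1) + i\<close>.\<close>
  have "card (?P i) = q ^ ((s + 1) * (k - i)) * gaussian_binomial F (s + i) i
      * gaussian_binomial F (v - s - i - 1) (k - i)" if "i \<le> k" for i
  proof -
    have le: "s + i + 1 \<le> v" using assms(11) that by simp
    have "card (carrier V) = card (U (s + i + 1)) * q ^ (v - s - i - 1)"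
      unfolding cV cU[OF le] power_add[symmetric] using le by simp
    then show ?thesis
      using card_avoiding_join_sets_grassmannian[OF sU[OF that], of "s + i" "s + 1" i "v - s - i - 1" "k - i"]
        cU[of "s + i"] cU[of "s + i + 1"] assms(11) that by (simp add: gaussian_binomial_eq add_ac)
  qed
  moreover have "gaussian_binomial F v k = card (grassmannian F V k)"
  proof -
    have "{X. sub X \<and> X \<subseteq> carrier V \<and> card X = q ^ k} = grassmannian F V k"
      using sub_subset by (auto simp: grassmannian_eq)
    then show ?thesis
      using card_subs_of_card[OF sub_self, of v k] cV by (simp add: gaussian_binomial_eq)
  qed
  moreover have "card (\<Union>i\<in>{0..k}. ?P i) = (\<Sum>i=0..k. card (?P i))"
  proof (rule card_UN_disjoint')
    show "disjoint_family_on ?P {0..k}" by (rule disj)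
    have "grassmannian F V k \<subseteq> {X. sub X \<and> True}" by (auto simp: grassmannian_eq)
    then show "finite (?P i)" if "i \<in> {0..k}" for i
      using finite_subset[OF _ finite_subs] union that by blast
  qed simp
  ultimately show ?thesis using union disj by simp
qed

end
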